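(* Let $m \ge 1$ and $1 \le k \le m$ be integers, let $\mathcal{X}$ be an instance space, let $\mathbf{P}$ be any probability distribution on $\mathcal{X} \times \{0,1\}^m$, and let $\boldsymbol{x} \in \mathcal{X}$. Let $\eta_j(\boldsymbol{x}) = \mathbf{P}(y_j = 1 \mid \boldsymbol{x})$, $j \in \{1,\dots,m\}$, be the marginal label probabilities at $\boldsymbol{x}$, and let $\boldsymbol{h}$ be any classifier delivering estimates $\hat\eta_j(\boldsymbol{x}) \in [0,1]$, $j \in \{1,\dots,m\}$, of these marginal probabilities. Let $\mathcal{Y}_k$ be a set of $k$ labels with the highest values of $\eta_j(\boldsymbol{x})$ and let $\hat{\mathcal{Y}}_k$ be a set of $k$ labels with the highest values of $\hat\eta_j(\boldsymbol{x})$ (ties broken arbitrarily). Then the conditional precision@$k$ regret of $\boldsymbol{h}$ satisfies $$ \mathrm{reg}_{p@k}(\boldsymbol{h} \mid \boldsymbol{x}) = \frac{1}{k}\sum_{i \in \mathcal{Y}_k} \eta_i(\boldsymbol{x}) - \frac{1}{k}\sum_{j \in \hat{\mathcal{Y}}_k} \eta_j(\boldsymbol{x}) \;\le\; 2 \max_{l \in \{1,\dots,m\}} \left| \eta_l(\boldsymbol{x}) - \hat\eta_l(\boldsymbol{x}) \right| . $$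
   Context: Multi-label classification: observations $(\boldsymbol{x}, \boldsymbol{y})$ with label vectors $\boldsymbol{y} = (y_1,\dots,y_m) \in \{0,1\}^m$ are drawn from $\mathbf{P}$, and $\mathbf{P}(\cdot \mid \boldsymbol{x})$ denotes the conditional distribution of $\boldsymbol{y}$ given $\boldsymbol{x}$. For a classifier $\boldsymbol{h}$ that predicts for $\boldsymbol{x}$ the set $\hat{\mathcal{Y}}_k$ of $k$ labels, $\mathrm{precision}@k(\boldsymbol{y},\boldsymbol{x},\boldsymbol{h}) = \frac1k \sum_{j \in \hat{\mathcal{Y}}_k} [\![ y_j = 1 ]\!]$, where $[\![\cdot]\!]$ is the $0/1$ indicator, and the loss is $\ell_{p@k} = 1 - \mathrm{precision}@k$. The conditional regret $\mathrm{reg}_{p@k}(\boldsymbol{h} \mid \boldsymbol{x})$ is the conditional expected loss of $\boldsymbol{h}$ at $\boldsymbol{x}$ minus the smallest achievable conditional expected loss at $\boldsymbol{x}$, which equals $\frac{1}{k}\sum_{i \in \mathcal{Y}_k} \eta_i(\boldsymbol{x}) - \frac{1}{k}\sum_{j \in \hat{\mathcal{Y}}_k} \eta_j(\boldsymbol{x})$. *)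

theory Defs
  imports "HOL-Probability.Probability"
begin

definition label_space :: "nat \<Rightarrow> (nat \<Rightarrow> nat) measure" where
  "label_space m = count_space ({1..m} \<rightarrow>\<^sub>E {0, 1})"

text \<open>\<open>K\<close> is a version of the conditional distribution of \<open>y\<close> given \<open>x\<close> under the joint
  distribution \<open>P\<close> of \<open>(x, y)\<close>: a Markov kernel that disintegrates \<open>P\<close> over its first marginal.
  As there are only finitely many label vectors, such a version exists for every \<open>P\<close>,
  whatever the measurable space \<open>X\<close>.\<close>

definition conditional_distribution ::
    "'x measure \<Rightarrow> nat \<Rightarrow> ('x \<times> (nat \<Rightarrow> nat)) measure \<Rightarrow> ('x \<Rightarrow> (nat \<Rightarrow> nat) measure) \<Rightarrow> bool" where
  "conditional_distribution X m P K \<longleftrightarrow>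
     K \<in> X \<rightarrow>\<^sub>M prob_algebra (label_space m) \<and>
     (\<forall>A\<in>sets X. \<forall>B\<in>sets (label_space m).
        emeasure P (A \<times> B) = (\<integral>\<^sup>+z\<in>A. emeasure (K z) B \<partial>distr P X fst))"

definition marginal :: "('x \<Rightarrow> (nat \<Rightarrow> nat) measure) \<Rightarrow> 'x \<Rightarrow> nat \<Rightarrow> real" where
  "marginal K x j = \<P>(y in K x. y j = 1)"

definition top_k :: "nat \<Rightarrow> nat \<Rightarrow> (nat \<Rightarrow> real) \<Rightarrow> nat set \<Rightarrow> bool" where
  "top_k m k v S \<longleftrightarrow> S \<subseteq> {1..m} \<and> card S = k \<and> (\<forall>i\<in>S. \<forall>j\<in>{1..m} - S. v j \<le> v i)"

definition classifiers :: "'x measure \<Rightarrow> nat \<Rightarrow> nat \<Rightarrow> ('x \<Rightarrow> nat set) set" where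
  "classifiers X m k = space X \<rightarrow> {S. S \<subseteq> {1..m} \<and> card S = k}"

definition precision_at :: "nat \<Rightarrow> (nat \<Rightarrow> nat) \<Rightarrow> 'x \<Rightarrow> ('x \<Rightarrow> nat set) \<Rightarrow> real" where
  "precision_at k y x h = 1 / real k * (\<Sum>j\<in>h x. of_bool (y j = 1))"

definition precision_loss :: "nat \<Rightarrow> (nat \<Rightarrow> nat) \<Rightarrow> 'x \<Rightarrow> ('x \<Rightarrow> nat set) \<Rightarrow> real" where
  "precision_loss k y x h = 1 - precision_at k y x h"

definition conditional_risk ::
    "('x \<Rightarrow> (nat \<Rightarrow> nat) measure) \<Rightarrow> nat \<Rightarrow> ('x \<Rightarrow> nat set) \<Rightarrow> 'x \<Rightarrow> real" where
  "conditional_risk K k h x = (\<integral>y. precision_loss k y x h \<partial>K x)"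

definition conditional_regret ::
    "'x measure \<Rightarrow> ('x \<Rightarrow> (nat \<Rightarrow> nat) measure) \<Rightarrow> nat \<Rightarrow> nat \<Rightarrow> ('x \<Rightarrow> nat set) \<Rightarrow> 'x \<Rightarrow> real" where
  "conditional_regret X K m k h x =
     conditional_risk K k h x - (INF g\<in>classifiers X m k. conditional_risk K k g x)"

end

theory Submission
  imports Defs
begin

text \<open>The conditional risk of predicting a set \<open>S\<close> is \<open>1 - (\<Sum>j\<in>S. \<eta> j) / k\<close>, so the Bayes
  prediction maximises \<open>\<Sum>j\<in>S. \<eta> j\<close> over the \<open>k\<close>-sets, and \<open>Y\<close> is a maximiser. As the predicted
  set maximises the sum of the estimates, replacing \<open>\<eta>\<close> by the estimates on both \<open>k\<close>-sets
  costs at most \<open>k\<close> times the largest estimation error for each of them.\<close>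

text \<open>Exchange argument: two sets of equal size have differences of equal size, so the labels
  of \<open>S - T\<close> can be matched one to one with those of \<open>T - S\<close>, and each
  match can only raise the value of \<open>v\<close>. The common part \<open>S \<inter> T\<close>
  cancels.\<close>

lemma top_k_sum_le:
  fixes v :: "nat \<Rightarrow> real"
  assumes "top_k m k v T" and "S \<subseteq> {1..m}" and "card S = k"
  shows "sum v S \<le> sum v T"
proof -
  have T: "T \<subseteq> {1..m}" "card T = k" "\<And>i j. i \<in> T \<Longrightarrow> j \<in> {1..m} - T \<Longrightarrow> v j \<le> v i"
    using assms(1) by (auto simp: top_k_def)
  have fin: "finite S" "finite T"
    using assms(2) T(1) finite_subset by blast+
  have "card (S - T) = card (T - S)"
    using card_Diff_subset_Int[of S T] card_Diff_subset_Int[of T S] fin assms(3) T(2)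
    by (simp add: Int_commute[of T S])
  then obtain f where f: "bij_betw f (S - T) (T - S)"
    using finite_same_card_bij[of "S - T" "T - S"] fin by auto
  have "sum v (S - T) \<le> (\<Sum>j\<in>S - T. v (f j))"
    using f assms(2) by (intro sum_mono T(3)) (auto dest: bij_betw_apply)
  also have "\<dots> = sum v (T - S)"
    using f by (rule sum.reindex_bij_betw)
  finally show ?thesis
    using sum.Int_Diff[OF fin(1), of v T] sum.Int_Diff[OF fin(2), of v S]
    by (simp add: Int_commute[of T S])
qed

text \<open>The difference splits as the sum of \<open>v - w\<close> over \<open>S\<close>, plus
  \<open>sum w S - sum w T\<close>, plus the sum of \<open>w - v\<close> over \<open>T\<close>. The
  middle term is at most 0 because \<open>T\<close> is optimal for \<open>w\<close>; each outer term
  has \<open>k\<close> summands bounded by \<open>\<epsilon>\<close>.\<close>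

lemma top_k_sum_diff_le:
  fixes v w :: "nat \<Rightarrow> real"
  assumes S: "S \<subseteq> {1..m}" "card S = k" and "top_k m k w T"
    and le: "\<And>l. l \<in> {1..m} \<Longrightarrow> \<bar>v l - w l\<bar> \<le> \<epsilon>"
  shows "sum v S - sum v T \<le> 2 * real k * \<epsilon>"
proof -
  have T: "T \<subseteq> {1..m}" "card T = k"
    using assms(3) by (auto simp: top_k_def)
  have "sum (\<lambda>l. v l - w l) S \<le> real k * \<epsilon>"
    using sum_bounded_above[of S "\<lambda>l. v l - w l" \<epsilon>] le[THEN abs_le_D1] S by (simp add: subset_iff)
  moreover have "sum (\<lambda>l. w l - v l) T \<le> real k * \<epsilon>"
    using sum_bounded_above[of T "\<lambda>l. w l - v l" \<epsilon>] le[THEN abs_le_D2] T by (simp add: subset_iff)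
  moreover have "sum w S \<le> sum w T"
    using assms(3) S by (rule top_k_sum_le)
  ultimately show ?thesis
    by (simp add: sum_subtractf)
qed

lemma conditional_distribution_kernel:
  assumes "conditional_distribution X m P K" and "x \<in> space X"
  shows "prob_space (K x)" and "sets (K x) = sets (label_space m)"
proof -
  have "K x \<in> space (prob_algebra (label_space m))"
    using assms by (auto simp: conditional_distribution_def dest: measurable_space)
  then show "prob_space (K x)" and "sets (K x) = sets (label_space m)"
    by (auto simp: space_prob_algebra)
qed

text \<open>Linearity of the integral: only the marginals enter, so dependence between labels is
  irrelevant to the risk.\<close>

lemma conditional_risk_eq:
  assumes "prob_space (K x)" and "sets (K x) = sets (label_space m)"
  shows "conditional_risk K k g x = 1 - 1 / real k * (\<Sum>j\<in>g x. marginal K x j)"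
proof -
  interpret prob_space "K x" by fact
  have ind: "(\<lambda>y. of_bool (y j = 1) :: real) = indicator {y. y j = 1}" for j :: nat
    by (auto simp: indicator_def)
  \<comment> \<open>Every subset of the finite label space is measurable; the intersection discards
    functions that are not label vectors.\<close>
  have ev: "{y. y j = 1} \<inter> space (K x) \<in> events" for j
    using assms(2) sets_eq_imp_space_eq[OF assms(2)] by (auto simp: label_space_def)
  have int: "integrable (K x) (\<lambda>y. of_bool (y j = 1) :: real)" for j
    unfolding ind integrable_indicator_iff using ev by (simp add: emeasure_eq_measure)
  have marg: "(\<integral>y. of_bool (y j = 1) \<partial>K x) = marginal K x j" for j
    unfolding ind by (simp add: marginal_def Int_def conj_commute)
  have "integrable (K x) (\<lambda>y. 1 / real k * (\<Sum>j\<in>g x. of_bool (y j = 1)))"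
    by (intro integrable_mult_right Bochner_Integration.integrable_sum int)
  then show ?thesis
    unfolding conditional_risk_def precision_loss_def precision_at_def
    by (simp only: Bochner_Integration.integral_diff integrable_const integral_mult_right_zero
        Bochner_Integration.integral_sum int marg) (simp add: prob_space)
qed

theorem theorem2:
  fixes m k :: nat
    and X :: "'x measure"
    and P :: "('x \<times> (nat \<Rightarrow> nat)) measure"
    and K :: "'x \<Rightarrow> (nat \<Rightarrow> nat) measure"
    and x :: 'x
    and \<eta> :: "nat \<Rightarrow> real"
    and est :: "'x \<Rightarrow> nat \<Rightarrow> real"
    and h :: "'x \<Rightarrow> nat set"
    and Y :: "nat set"
  assumes "1 \<le> m" and "1 \<le> k" and "k \<le> m"
    and "prob_space P" and "sets P = sets (X \<Otimes>\<^sub>M label_space m)"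
    and "conditional_distribution X m P K"
    and "x \<in> space X"
    and "\<And>j. j \<in> {1..m} \<Longrightarrow> \<eta> j = marginal K x j"
    and "\<And>j. j \<in> {1..m} \<Longrightarrow> est x j \<in> {0..1}"
    and "top_k m k \<eta> Y"
    and "top_k m k (est x) (h x)"
  shows "conditional_regret X K m k h x
           = 1 / real k * (\<Sum>i\<in>Y. \<eta> i) - 1 / real k * (\<Sum>j\<in>h x. \<eta> j)
         \<and> 1 / real k * (\<Sum>i\<in>Y. \<eta> i) - 1 / real k * (\<Sum>j\<in>h x. \<eta> j)
           \<le> 2 * (MAX l\<in>{1..m}. \<bar>\<eta> l - est x l\<bar>)"
proof -
  note kernel = conditional_distribution_kernel[OF assms(6,7)]
  have Y: "Y \<subseteq> {1..m}" "card Y = k" and h: "h x \<subseteq> {1..m}"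
    using assms(10,11) by (auto simp: top_k_def)
  \<comment> \<open>\<open>\<eta>\<close> is tied to the marginals only on \<open>{1..m}\<close>,
    hence the restriction on \<open>g x\<close>.\<close>
  have risk: "conditional_risk K k g x = 1 - 1 / real k * sum \<eta> (g x)" if "g x \<subseteq> {1..m}" for g
  proof -
    have "(\<Sum>j\<in>g x. marginal K x j) = sum \<eta> (g x)"
      using that assms(8) by (intro sum.cong) auto
    then show ?thesis
      by (simp add: conditional_risk_eq[of K x m, OF kernel])
  qed
  have "(INF g\<in>classifiers X m k. conditional_risk K k g x) = 1 - 1 / real k * sum \<eta> Y"
  \<comment> \<open>The infimum is attained, by the classifier that predicts \<open>Y\<close> at
    every instance.\<close>
  proof (rule cInf_eq_minimum)
    show "1 - 1 / real k * sum \<eta> Y \<in> (\<lambda>g. conditional_risk K k g x) ` classifiers X m k"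
      using risk[of "\<lambda>_. Y"] Y by (intro image_eqI[of _ _ "\<lambda>_. Y"]) (auto simp: classifiers_def)
  next
    fix r assume "r \<in> (\<lambda>g. conditional_risk K k g x) ` classifiers X m k"
    then obtain g where g: "g x \<subseteq> {1..m}" "card (g x) = k" "r = conditional_risk K k g x"
      using assms(7) by (auto simp: classifiers_def)
    have "sum \<eta> (g x) \<le> sum \<eta> Y"
      using assms(10) g(1,2) by (rule top_k_sum_le)
    then show "1 - 1 / real k * sum \<eta> Y \<le> r"
      by (simp add: g(3) risk[of g, OF g(1)] divide_right_mono)
  qed
  then have regret: "conditional_regret X K m k h x
      = 1 / real k * sum \<eta> Y - 1 / real k * sum \<eta> (h x)"
    using risk[of h, OF h] by (simp add: conditional_regret_def)
  have "sum \<eta> Y - sum \<eta> (h x) \<le> 2 * real k * (MAX l\<in>{1..m}. \<bar>\<eta> l - est x l\<bar>)"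
    \<comment> \<open>Here \<open>\<epsilon>\<close> is the maximal estimation error, which bounds
      each single error since \<open>{1..m}\<close> is finite.\<close>
    using Y assms(11) by (rule top_k_sum_diff_le) simp
  then have "1 / real k * sum \<eta> Y - 1 / real k * sum \<eta> (h x)
      \<le> 2 * (MAX l\<in>{1..m}. \<bar>\<eta> l - est x l\<bar>)"
    using assms(2) by (simp add: field_simps)
  with regret show ?thesis
    by (rule conjI)
qed

end
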